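(* Let $\alpha$ be any positive real and let $r\geq 6$ be any integer. Let $A(\alpha,r)$ be an algorithm solving distance-constrained exploration for all instances of $\mathcal{I}(\alpha,r)$. Then for every integer $k>1$ there exists an instance $(G=(V,E),l_s,\alpha)$ of $\mathcal{I}(\alpha,r)$ such that $|V|\geq k$ and for which the penalty of $A$ is at least $$\left(\frac{|V|}{16\left(2\left\lfloor(1+\alpha)r\right\rfloor+3\right)}\right)^2 .$$
   Context: Model. A mobile agent explores a finite, simple, undirected, connected graph $G=(V,E)$ starting from a source node $s$. Nodes have pairwise distinct integer labels; at each node $v$ the incident edges carry distinct local port numbers $0,\dots,\deg(v)-1$, with no relation between the two ports of an edge. Initially the agent knows only the label and degree of $s$. It runs a deterministic algorithm: at each step the algorithm, based on everything memorized so far, chooses a port at the current node and the agent traverses the corresponding edge; on arrival it learns the label and degree of the new node and the incoming port number. The agent has unbounded memory. Exploration requires traversing every edge (hence visiting every node) at least once. Distance-constrained exploration: let $r$ be the eccentricity of $s$ in $G$ and $\alpha>0$ a real constant, and let $D=(1+\alpha)r$. At every moment the agent must know a path of length at most $D$ (i.e. a sequence of at most $D$ edges already traversed by the agent) from its current node to $s$. Both $\alpha$ and $r$ are given to the algorithm in advance. An instance is a tuple $(G,l_s,\alpha)$ where $l_s$ is the label of $s$; $\mathcal{I}(\alpha,r)$ denotes the set of all instances $(G,l_s,\alpha)$ in which the eccentricity of the node labeled $l_s$ is $r$. An algorithm $A(\alpha,r)$ solves the problem for all instances of $\mathcal{I}(\alpha,r)$ if on each such instance it explores the whole graph while always respecting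 the distance constraint, and terminates. The penalty of an algorithm on an instance with graph $G=(V,E)$ is the number of edge traversals it performs in excess of $|E|$. *)

theory Defs
  imports Complex_Main
begin

text \<open>Since node labels are pairwise distinct integers, a node is identified with its label.
  \<open>port G v u\<close> is the port number at \<open>v\<close> of the edge joining \<open>v\<close> and \<open>u\<close>; it is only
  meaningful when this edge exists.\<close>

record port_graph =
  verts :: "int set"
  edges :: "int set set"
  port :: "int \<Rightarrow> int \<Rightarrow> nat"

definition neighbours :: "port_graph \<Rightarrow> int \<Rightarrow> int set" where
  "neighbours G v = {u. {v, u} \<in> edges G}"

definition deg :: "port_graph \<Rightarrow> int \<Rightarrow> nat" where
  "deg G v = card (neighbours G v)"

text \<open>A walk is given by the list of its nodes, so its length is one less than the length of the
  list.\<close>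

definition walk_betw :: "int set set \<Rightarrow> int \<Rightarrow> int list \<Rightarrow> int \<Rightarrow> bool" where
  "walk_betw F u xs v \<longleftrightarrow>
     xs \<noteq> [] \<and> hd xs = u \<and> last xs = v \<and> successively (\<lambda>x y. {x, y} \<in> F) xs"

definition walk_length :: "int list \<Rightarrow> nat" where
  "walk_length xs = length xs - 1"

definition valid_graph :: "port_graph \<Rightarrow> bool" where
  "valid_graph G \<longleftrightarrow>
     finite (verts G) \<and>
     edges G \<subseteq> {{u, v} | u v. u \<in> verts G \<and> v \<in> verts G \<and> u \<noteq> v} \<and>
     (\<forall>u \<in> verts G. \<forall>v \<in> verts G. \<exists>xs. walk_betw (edges G) u xs v) \<and>
     (\<forall>v \<in> verts G. bij_betw (port G v) (neighbours G v) {..<deg G v})"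

definition distance :: "port_graph \<Rightarrow> int \<Rightarrow> int \<Rightarrow> nat" where
  "distance G u v = (LEAST n. \<exists>xs. walk_betw (edges G) u xs v \<and> walk_length xs = n)"

definition eccentricity :: "port_graph \<Rightarrow> int \<Rightarrow> nat" where
  "eccentricity G s = Max (distance G s ` verts G)"

definition instances :: "real \<Rightarrow> nat \<Rightarrow> (port_graph \<times> int \<times> real) set" where
  "instances \<alpha> r =
     {(G, s, \<alpha>) | G s. valid_graph G \<and> s \<in> verts G \<and> eccentricity G s = r}"

text \<open>One entry of a history records, for one edge traversal, the port by which the agent left, the
  port by which it arrived, and the label and degree of the node reached; entries are in
  chronological order. An algorithm receives the label and degree of the source together with the
  history so far, and returns the port to be taken next, or \<open>None\<close> in order to terminate.\<close>

type_synonym history = "(nat \<times> nat \<times> int \<times> nat) list"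

type_synonym algorithm = "int \<times> nat \<Rightarrow> history \<Rightarrow> nat option"

text \<open>\<open>execution A G s h v\<close>: running \<open>A\<close> on \<open>G\<close> from \<open>s\<close>, the agent at some moment has history \<open>h\<close>
  and is located at \<open>v\<close>. An execution choosing a port that does not exist at the current node is
  stuck without having terminated.\<close>

inductive execution :: "algorithm \<Rightarrow> port_graph \<Rightarrow> int \<Rightarrow> history \<Rightarrow> int \<Rightarrow> bool"
  for A G s where
  start: "execution A G s [] s"
| move: "execution A G s (h @ [(p, port G u v, u, deg G u)]) u"
    if "execution A G s h v" "A (s, deg G s) h = Some p" "u \<in> neighbours G v" "port G v u = p"

definition terminates_with :: "algorithm \<Rightarrow> port_graph \<Rightarrow> int \<Rightarrow> history \<Rightarrow> bool" where
  "terminates_with A G s h \<longleftrightarrow> (\<exists>v. execution A G s h v) \<and> A (s, deg G s) h = None"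

definition visited_nodes :: "int \<Rightarrow> history \<Rightarrow> int list" where
  "visited_nodes s h = s # map (\<lambda>(_, _, u, _). u) h"

definition traversed_edges :: "int \<Rightarrow> history \<Rightarrow> int set set" where
  "traversed_edges s h =
     {{visited_nodes s h ! i, visited_nodes s h ! Suc i} | i. i < length h}"

definition respects_distance :: "algorithm \<Rightarrow> port_graph \<Rightarrow> int \<Rightarrow> real \<Rightarrow> bool" where
  "respects_distance A G s D \<longleftrightarrow>
     (\<forall>h v. execution A G s h v \<longrightarrow>
        (\<exists>xs. walk_betw (traversed_edges s h) v xs s \<and> real (walk_length xs) \<le> D))"

definition explores :: "algorithm \<Rightarrow> port_graph \<Rightarrow> int \<Rightarrow> bool" where
  "explores A G s \<longleftrightarrow>
     (\<exists>h. terminates_with A G s h \<and> edges G \<subseteq> traversed_edges s h)"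

definition solves :: "algorithm \<Rightarrow> real \<Rightarrow> nat \<Rightarrow> bool" where
  "solves A \<alpha> r \<longleftrightarrow>
     (\<forall>G s. (G, s, \<alpha>) \<in> instances \<alpha> r \<longrightarrow>
        explores A G s \<and> respects_distance A G s ((1 + \<alpha>) * real r))"

text \<open>By \<open>terminates_with_unique\<close> below, the history at termination is unique if it exists.\<close>

definition traversals :: "algorithm \<Rightarrow> port_graph \<Rightarrow> int \<Rightarrow> nat" where
  "traversals A G s = length (THE h. terminates_with A G s h)"

definition penalty :: "algorithm \<Rightarrow> port_graph \<Rightarrow> int \<Rightarrow> int" where
  "penalty A G s = int (traversals A G s) - int (card (edges G))"

lemma execution_in_verts:
  assumes "valid_graph G" "s \<in> verts G" "execution A G s h v"
  shows "v \<in> verts G"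
  using assms(3)
proof induction
  case (move h v p u)
  then have "{v, u} \<in> edges G" by (simp add: neighbours_def)
  then obtain a b where "{v, u} = {a, b}" "a \<in> verts G" "b \<in> verts G"
    using assms(1) unfolding valid_graph_def by blast
  then show ?case by (metis doubleton_eq_iff)
qed (use assms in auto)

lemma execution_prefix:
  assumes "execution A G s h v" "n < length h"
  shows "\<exists>w. execution A G s (take n h) w \<and> A (s, deg G s) (take n h) \<noteq> None"
  using assms
proof induction
  case (move h v p u)
  then show ?case by (cases "n = length h") auto
qed simp

lemma execution_deterministic:
  assumes G: "valid_graph G" "s \<in> verts G"
    and "execution A G s h v" "execution A G s h' v'" "length h = length h'"
  shows "h = h' \<and> v = v'"
  using assms(3-)
proof (induction arbitrary: h' v' rule: execution.induct)
  case start
  then show ?case by (auto elim: execution.cases)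
next
  case (move h v p u)
  note IH = move.IH and mv = move.hyps and len = move.prems(2)
  from move.prems(1) show ?case
  proof (cases rule: execution.cases)
    case start
    then show ?thesis using len by simp
  next
    case (move g w q)
    have eq: "h = g" "v = w"
      using IH[OF move(2)] len move(1) by auto
    have "inj_on (port G v) (neighbours G v)"
      using G execution_in_verts[OF G mv(1)] by (auto simp: valid_graph_def bij_betw_def)
    then have "u = v'"
      using mv move eq by (auto dest: inj_onD)
    then show ?thesis
      using eq move mv by auto
  qed
qed

lemma terminates_with_unique:
  assumes G: "valid_graph G" "s \<in> verts G"
    and h: "terminates_with A G s h" and h': "terminates_with A G s h'"
  shows "h = h'"
proof -
  have not_less: "\<not> length g < length g'"
    if g: "terminates_with A G s g" and g': "terminates_with A G s g'" for g g'
  proof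
    assume less: "length g < length g'"
    obtain v v' where v: "execution A G s g v" "execution A G s g' v'"
      using g g' by (auto simp: terminates_with_def)
    obtain w where w: "execution A G s (take (length g) g') w"
      "A (s, deg G s) (take (length g) g') \<noteq> None"
      using execution_prefix[OF v(2) less] by blast
    have "g = take (length g) g'"
      using execution_deterministic[OF G v(1) w(1)] less by simp
    then show False
      using w(2) g by (simp add: terminates_with_def)
  qed
  have "length h = length h'"
    using not_less[OF h h'] not_less[OF h' h] by simp
  then show ?thesis
    using h h' execution_deterministic[OF G] by (auto simp: terminates_with_def)
qed

end

theory Submission
  imports Defs
begin

text \<open>Let \<open>D = \<lfloor>(1 + \<alpha>) r\<rfloor>\<close>, and consider a chain of layers \<open>L\<^sub>0, \<dots>, L\<^sub>D\<^sub>+\<^sub>1\<close>, where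
  \<open>L\<^sub>0 = {s}\<close> and each of \<open>L\<^sub>1, \<dots>, L\<^sub>D\<^sub>+\<^sub>1\<close> has \<open>m\<close> nodes, with all edges between
  consecutive layers. The adversary fixes ports only when they are used, and lets a new port lead forward whenever the current node still has an untraversed forward edge. As long as
  every two consecutive layers other than \<open>L\<^sub>0, L\<^sub>1\<close> have an untraversed edge between them, one such
  edge per pair may turn out to be subdivided and linked to a hub, which brings every node within
  distance 6 of \<open>s\<close>; a path attached to the hub makes the eccentricity exactly \<open>r\<close>. So the agent
  always faces a possible instance, and since it knows no shortcut it can never enter \<open>L\<^sub>D\<^sub>+\<^sub>1\<close>.

  Each arrival at a node \<open>x\<close> is followed by a departure, which uses a new forward edge, or an already
  traversed edge, or else a new backward edge when all forward edges at \<open>x\<close> have been traversed. Hence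
  the number of traversed backward edges at \<open>x\<close> is at most the number of traversed forward edges plus
  the number of departures along old edges, plus one if the agent is at \<open>x\<close>. Summing over all layers
  from \<open>L\<^sub>i\<close> on telescopes: the number of traversed edges between \<open>L\<^sub>i\<^sub>-\<^sub>1\<close> and \<open>L\<^sub>i\<close> is at most one plus
  the penalty paid so far. Therefore the penalty is at least \<open>m\<^sup>2 - 2\<close> before the last of the \<open>m\<^sup>2\<close>
  edges between two layers is traversed.\<close>

section \<open>Walks and histories\<close>

lemma walk_betw_snoc:
  assumes "walk_betw F a xs b" "{b, c} \<in> F"
  shows "walk_betw F a (xs @ [c]) c" "walk_length (xs @ [c]) = Suc (walk_length xs)"
  using assms by (auto simp: walk_betw_def walk_length_def successively_append_iff)

lemma walk_betw_rev:
  assumes "walk_betw F a xs b"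
  shows "walk_betw F b (rev xs) a"
  using assms by (auto simp: walk_betw_def hd_rev last_rev insert_commute)

lemma walk_betw_trans:
  assumes "walk_betw F a xs b" "walk_betw F b ys c"
  shows "walk_betw F a (xs @ tl ys) c"
proof (cases ys)
  case Nil
  then show ?thesis using assms by (simp add: walk_betw_def)
next
  case (Cons z zs)
  then show ?thesis using assms
    by (cases zs) (auto simp: walk_betw_def successively_append_iff)
qed

text \<open>Each step of the walk raises the potential by at most one. This serves twice: with
  \<open>lay\<close>, to bound how deep the agent can be, and with \<open>level\<close>, to bound
  the eccentricity from below.\<close>

lemma walk_potential:
  fixes \<phi> :: "int \<Rightarrow> nat"
  assumes "walk_betw F a xs b" "\<And>x y. {x, y} \<in> F \<Longrightarrow> \<phi> y \<le> Suc (\<phi> x)"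
  shows "\<phi> b \<le> \<phi> a + walk_length xs"
proof -
  have "xs \<noteq> [] \<Longrightarrow> successively (\<lambda>x y. {x, y} \<in> F) xs \<Longrightarrow>
    \<phi> (last xs) \<le> \<phi> (hd xs) + (length xs - 1)"
  proof (induction xs)
    case (Cons x xs)
    then show ?case
      using assms(2)[of x "hd xs"] by (cases xs) auto
  qed simp
  then show ?thesis using assms(1) by (auto simp: walk_betw_def walk_length_def)
qed

lemma distance_le:
  assumes "walk_betw (edges G) a xs b"
  shows "distance G a b \<le> walk_length xs"
  unfolding distance_def by (rule Least_le) (use assms in auto)

lemma distance_ge_potential:
  fixes \<phi> :: "int \<Rightarrow> nat"
  assumes "walk_betw (edges G) a xs b" "\<And>x y. {x, y} \<in> edges G \<Longrightarrow> \<phi> y \<le> Suc (\<phi> x)"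
  shows "\<phi> b \<le> \<phi> a + distance G a b"
proof -
  have "\<exists>ys. walk_betw (edges G) a ys b \<and> walk_length ys = distance G a b"
    unfolding distance_def by (rule LeastI_ex) (use assms(1) in blast)
  then obtain ys where "walk_betw (edges G) a ys b" "walk_length ys = distance G a b" by blast
  then show ?thesis using walk_potential[of "edges G" a ys b \<phi>] assms(2) by simp
qed

lemma traversed_edges_Nil: "traversed_edges s [] = {}"
  by (simp add: traversed_edges_def)

lemma traversed_edges_image:
  "traversed_edges s h =
     (\<lambda>i. {visited_nodes s h ! i, visited_nodes s h ! Suc i}) ` {..<length h}"
  by (auto simp: traversed_edges_def)

lemma finite_traversed_edges [simp]: "finite (traversed_edges s h)"
  by (simp add: traversed_edges_image)

lemma traversed_edges_snoc:
  "traversed_edges s (h @ [(p, q, u, d)]) =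
     insert {last (visited_nodes s h), u} (traversed_edges s h)"
proof -
  have v: "visited_nodes s (h @ [(p, q, u, d)]) = visited_nodes s h @ [u]"
    by (simp add: visited_nodes_def)
  have l: "length (visited_nodes s h) = Suc (length h)" by (simp add: visited_nodes_def)
  then have n: "last (visited_nodes s h) = visited_nodes s h ! length h"
    by (metis diff_Suc_1 last_conv_nth length_0_conv nat.distinct(1))
  show ?thesis
    unfolding traversed_edges_image v n by (simp add: lessThan_Suc nth_append l)
qed

lemma card_traversed_edges_append:
  "card (traversed_edges s (h @ g)) \<le> card (traversed_edges s h) + length g"
proof (induction g rule: rev_induct)
  case (snoc e g)
  obtain p q u d where e: "e = (p, q, u, d)" by (cases e)
  have "card (traversed_edges s ((h @ g) @ [e])) \<le> Suc (card (traversed_edges s (h @ g)))"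
    unfolding e traversed_edges_snoc by (simp add: card_insert_if)
  then show ?case using snoc by simp
qed simp

section \<open>Prolonging a run up to termination\<close>

lemma execution_prefix_append:
  "execution A G s (h @ g) v \<Longrightarrow> \<exists>w. execution A G s h w"
proof (induction g arbitrary: v rule: rev_induct)
  case (snoc e g)
  from snoc.prems have "\<exists>w. execution A G s (h @ g) w"
    by (cases rule: execution.cases) auto
  then show ?case using snoc.IH by blast
qed auto

text \<open>By determinism, \<open>h\<close> and the terminating history are comparable. If
  \<open>h\<close> were the longer one, the algorithm would already have stopped; if they had equal
  length, they would coincide although \<open>h\<close> misses an edge. So \<open>h\<close> is a
  proper prefix.\<close>

lemma explores_extends:
  assumes G: "valid_graph G" "s \<in> verts G"
    and ex: "explores A G s" and h: "execution A G s h v"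
    and unex: "\<not> edges G \<subseteq> traversed_edges s h"
  obtains e g where "terminates_with A G s (h @ e # g)"
    "edges G \<subseteq> traversed_edges s (h @ e # g)"
proof -
  obtain h' where h': "terminates_with A G s h'" "edges G \<subseteq> traversed_edges s h'"
    using ex by (auto simp: explores_def)
  then obtain v' where v': "execution A G s h' v'" by (auto simp: terminates_with_def)
  have "length h < length h'"
  proof (rule ccontr)
    assume "\<not> ?thesis"
    then consider "length h = length h'" | "length h' < length h" by linarith
    then show False
    proof cases
      case 1
      then show False using execution_deterministic[OF G h v'] h' unex by simp
    next
      case 2
      then obtain w where "execution A G s (take (length h') h) w"
        "A (s, deg G s) (take (length h') h) \<noteq> None"
        using execution_prefix[OF h] by blast
      moreover from this 2 have "take (length h') h = h'"
        using execution_deterministic[OF G _ v'] by simp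
      ultimately show False using h' by (simp add: terminates_with_def)
    qed
  qed
  then obtain w where "execution A G s (take (length h) h') w"
    using execution_prefix[OF v'] by blast
  then have "take (length h) h' = h"
    using execution_deterministic[OF G h] \<open>length h < length h'\<close> by fastforce
  then obtain g where g: "h' = h @ g" by (metis append_take_drop_id)
  with \<open>length h < length h'\<close> show ?thesis using that h' by (cases g) auto
qed

lemma explores_next_port:
  assumes G: "valid_graph G" "s \<in> verts G"
    and ex: "explores A G s" and h: "execution A G s h v"
    and unex: "\<not> edges G \<subseteq> traversed_edges s h"
  obtains u where "u \<in> neighbours G v" "A (s, deg G s) h = Some (port G v u)"
proof -
  obtain e g where "terminates_with A G s (h @ e # g)"
    using explores_extends[OF assms] .
  then obtain w where "execution A G s ((h @ [e]) @ g) w"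
    by (auto simp: terminates_with_def)
  then obtain w where "execution A G s (h @ [e]) w"
    using execution_prefix_append by blast
  then show ?thesis
  proof (cases rule: execution.cases)
    case (move h2 v2 p)
    then have "v2 = v" using execution_deterministic[OF G h] by auto
    then show ?thesis using that move by auto
  qed auto
qed

text \<open>Every later traversal adds at most one new edge, so the excess of traversals over
  distinct traversed edges never decreases.\<close>

lemma penalty_ge_prefix:
  assumes G: "valid_graph G" "s \<in> verts G"
    and ex: "explores A G s" and h: "execution A G s h v"
    and unex: "\<not> edges G \<subseteq> traversed_edges s h"
  shows "int (length h) - int (card (traversed_edges s h)) \<le> penalty A G s"
proof -
  obtain e g where *: "terminates_with A G s (h @ e # g)"
    "edges G \<subseteq> traversed_edges s (h @ e # g)"
    using explores_extends[OF assms] .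
  have "(THE h. terminates_with A G s h) = h @ e # g"
    using * terminates_with_unique[OF G] by blast
  then have "traversals A G s = length h + length (e # g)"
    by (simp add: traversals_def)
  moreover have "card (edges G) \<le> card (traversed_edges s h) + length (e # g)"
    using card_traversed_edges_append[of s h "e # g"] card_mono[OF _ *(2)] by simp
  ultimately show ?thesis by (simp add: penalty_def)
qed

text \<open>The points of \<open>B - A\<close> and the values not yet taken are equally many, so any
  bijection between them can be glued to \<open>f\<close>. This turns a partial port numbering at a
  node into a full one.\<close>

lemma bij_betw_extend:
  fixes f :: "'a \<Rightarrow> nat"
  assumes "finite B" "A \<subseteq> B" "inj_on f A" "f ` A \<subseteq> {..<card B}"
  shows "\<exists>g. bij_betw g B {..<card B} \<and> (\<forall>x\<in>A. g x = f x)"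
proof -
  have finA: "finite A" using assms finite_subset by blast
  have "card (B - A) = card ({..<card B} - f ` A)"
    using assms finA by (simp add: card_Diff_subset card_image)
  then obtain k where k: "bij_betw k (B - A) ({..<card B} - f ` A)"
    using assms(1) by (metis finite_Diff finite_lessThan finite_same_card_bij)
  define g where "g x = (if x \<in> A then f x else k x)" for x
  have "bij_betw g A (f ` A)" "bij_betw g (B - A) ({..<card B} - f ` A)"
    using assms(3) k by (auto simp: g_def bij_betw_def inj_on_def)
  then have "bij_betw g (A \<union> (B - A)) (f ` A \<union> ({..<card B} - f ` A))"
    by (rule bij_betw_combine) auto
  moreover have "A \<union> (B - A) = B" "f ` A \<union> ({..<card B} - f ` A) = {..<card B}"
    using assms by auto
  ultimately show ?thesis by (auto simp: g_def)
qed

section \<open>The layered chain and its completions\<close>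

text \<open>Chain nodes have nonnegative labels, which leaves the negative ones for the nodes that a
  completion adds.\<close>

locale layered_chain =
  fixes V :: "int set" and lay :: "int \<Rightarrow> nat" and s :: int and m N :: nat
  assumes finite_V: "finite V"
    and V_nonneg: "x \<in> V \<Longrightarrow> 0 \<le> x"
    and lay_le: "x \<in> V \<Longrightarrow> lay x \<le> N"
    and layer_0: "{x \<in> V. lay x = 0} = {s}"
    and card_layer_raw: "\<lbrakk>1 \<le> j; j \<le> N\<rbrakk> \<Longrightarrow> card {x \<in> V. lay x = j} = m"
    and N_ge: "2 \<le> N"
    and m_ge: "2 \<le> m"
begin

definition layer :: "nat \<Rightarrow> int set" where
  "layer j = {x \<in> V. lay x = j}"

definition bwd :: "int \<Rightarrow> int set" where
  "bwd x = {y \<in> V. lay x = Suc (lay y)}"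

definition nbr :: "int \<Rightarrow> int set" where
  "nbr x = layer (Suc (lay x)) \<union> bwd x"

definition chain_edges :: "int set set" where
  "chain_edges = {{x, y} | x y. x \<in> V \<and> y \<in> V \<and> lay y = Suc (lay x)}"

lemma s_in_V: "s \<in> V" and lay_s: "lay s = 0"
  using layer_0 by auto

lemma lay_0_iff: "x \<in> V \<Longrightarrow> lay x = 0 \<longleftrightarrow> x = s"
  using layer_0 by auto

lemma card_layer: "\<lbrakk>1 \<le> j; j \<le> N\<rbrakk> \<Longrightarrow> card (layer j) = m"
  using card_layer_raw by (simp add: layer_def)

lemma finite_layer [simp]: "finite (layer j)" and finite_bwd [simp]: "finite (bwd x)"
  and finite_nbr [simp]: "finite (nbr x)"
  using finite_V by (auto simp: layer_def bwd_def nbr_def)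

lemma chain_edge_iff: "{x, y} \<in> chain_edges \<longleftrightarrow> x \<in> V \<and> y \<in> nbr x"
  by (auto simp: chain_edges_def nbr_def layer_def bwd_def doubleton_eq_iff)

lemma chain_edges_doubleton: "e \<in> chain_edges \<Longrightarrow> \<exists>x y. e = {x, y}"
  by (auto simp: chain_edges_def)

lemma finite_chain_edges: "finite chain_edges"
  by (rule finite_subset[of _ "Pow V"]) (auto simp: chain_edges_def finite_V)

end

text \<open>For \<open>1 \<le> j < N\<close> the edge between \<open>w j\<close> and \<open>y j\<close> is subdivided by the new node \<open>-j\<close>. All these
  nodes are adjacent to the hub \<open>-N\<close>, from which a path with \<open>r - 3\<close> edges leads to \<open>-(N + r - 3)\<close>.
  Subdividing preserves the degrees of the chain nodes, so an agent that has traversed none of the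
  subdivided edges cannot tell the completion from the chain.\<close>

locale completed_chain = layered_chain +
  fixes r :: nat and w y :: "nat \<Rightarrow> int"
  assumes r_ge: "6 \<le> r"
    and w_layer: "\<lbrakk>1 \<le> j; j < N\<rbrakk> \<Longrightarrow> w j \<in> layer j"
    and y_layer: "\<lbrakk>1 \<le> j; j < N\<rbrakk> \<Longrightarrow> y j \<in> layer (Suc j)"
begin

definition subdivided :: "int set set" where
  "subdivided = {{w j, y j} | j. 1 \<le> j \<and> j < N}"

definition full_verts :: "int set" where
  "full_verts = V \<union> {- int (N + r - 3) .. -1}"

definition full_edges :: "int set set" where
  "full_edges = (chain_edges - subdivided)
     \<union> {{w j, - int j} | j. 1 \<le> j \<and> j < N}
     \<union> {{y j, - int j} | j. 1 \<le> j \<and> j < N}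
     \<union> {{- int j, - int N} | j. 1 \<le> j \<and> j < N}
     \<union> {{- int i, - int (Suc i)} | i. N \<le> i \<and> i < N + r - 3}"

lemma w_props: "\<lbrakk>1 \<le> j; j < N\<rbrakk> \<Longrightarrow> w j \<in> V \<and> lay (w j) = j"
  and y_props: "\<lbrakk>1 \<le> j; j < N\<rbrakk> \<Longrightarrow> y j \<in> V \<and> lay (y j) = Suc j"
  using w_layer y_layer by (auto simp: layer_def)

lemma full_edges_cases:
  assumes "{a, b} \<in> full_edges"
  obtains (chain) "{a, b} \<in> chain_edges" "{a, b} \<notin> subdivided"
  | (w) j where "1 \<le> j" "j < N" "{a, b} = {w j, - int j}"
  | (y) j where "1 \<le> j" "j < N" "{a, b} = {y j, - int j}"
  | (hub) j where "1 \<le> j" "j < N" "{a, b} = {- int j, - int N}"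
  | (path) i where "N \<le> i" "i < N + r - 3" "{a, b} = {- int i, - int (Suc i)}"
  using assms unfolding full_edges_def by blast

lemma full_edges_w: "\<lbrakk>1 \<le> j; j < N\<rbrakk> \<Longrightarrow> {w j, - int j} \<in> full_edges"
  and full_edges_hub: "\<lbrakk>1 \<le> j; j < N\<rbrakk> \<Longrightarrow> {- int j, - int N} \<in> full_edges"
  and full_edges_path: "\<lbrakk>N \<le> i; i < N + r - 3\<rbrakk> \<Longrightarrow> {- int i, - int (Suc i)} \<in> full_edges"
  unfolding full_edges_def by blast+

lemma full_edges_subset: "full_edges \<subseteq> {{a, b} | a b. a \<in> full_verts \<and> b \<in> full_verts \<and> a \<noteq> b}"
proof
  fix e assume e: "e \<in> full_edges"
  then obtain a b where ab: "e = {a, b}"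
    using chain_edges_doubleton by (fastforce simp: full_edges_def)
  have "a \<in> full_verts \<and> b \<in> full_verts \<and> a \<noteq> b"
    using e[unfolded ab]
  proof (cases rule: full_edges_cases)
    case chain
    then show ?thesis
      by (auto simp: chain_edge_iff nbr_def bwd_def layer_def full_verts_def)
  next
    case (w j)
    then show ?thesis using w_props[of j] V_nonneg[of "w j"] r_ge
      by (auto simp: doubleton_eq_iff full_verts_def)
  next
    case (y j)
    then show ?thesis using y_props[of j] V_nonneg[of "y j"] r_ge
      by (auto simp: doubleton_eq_iff full_verts_def)
  qed (use r_ge N_ge in \<open>auto simp: doubleton_eq_iff full_verts_def\<close>)
  then show "e \<in> {{a, b} | a b. a \<in> full_verts \<and> b \<in> full_verts \<and> a \<noteq> b}"
    using ab by blast
qed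

text \<open>The node that takes the place of the chain neighbour \<open>u\<close> of
  \<open>x\<close>: the node subdividing an edge between layers \<open>j\<close> and
  \<open>j + 1\<close> is \<open>-j\<close>, hence the minimum.\<close>

definition redirect :: "int \<Rightarrow> int \<Rightarrow> int" where
  "redirect x u = (if {x, u} \<in> subdivided then - int (min (lay x) (lay u)) else u)"

lemma redirect_w: "\<lbrakk>1 \<le> j; j < N\<rbrakk> \<Longrightarrow> redirect (w j) (y j) = - int j"
  and redirect_y: "\<lbrakk>1 \<le> j; j < N\<rbrakk> \<Longrightarrow> redirect (y j) (w j) = - int j"
  using w_props[of j] y_props[of j] by (auto simp: redirect_def subdivided_def doubleton_eq_iff)

lemma redirect_subdivided:
  assumes "1 \<le> j" "j < N" "{x, u} = {w j, y j}"
  shows "redirect x u = - int j"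
proof -
  have "x = w j \<and> u = y j \<or> x = y j \<and> u = w j" using assms(3) by (simp only: doubleton_eq_iff)
  then show ?thesis using assms(1,2) redirect_w redirect_y by blast
qed

lemma neighbours_full:
  assumes x: "x \<in> V"
  shows "{u. {x, u} \<in> full_edges} = redirect x ` nbr x"
proof (intro equalityI subsetI)
  fix u assume "u \<in> {u. {x, u} \<in> full_edges}"
  then have "{x, u} \<in> full_edges" by simp
  then show "u \<in> redirect x ` nbr x"
  proof (cases rule: full_edges_cases)
    case chain
    then show ?thesis by (auto simp: chain_edge_iff redirect_def image_iff intro!: bexI[of _ u])
  next
    case (w j)
    then have "x = w j" "u = - int j" using V_nonneg[OF x] by (auto simp: doubleton_eq_iff)
    moreover have "y j \<in> nbr (w j)"
      using w y_props[of j] w_props[of j] by (simp add: nbr_def layer_def)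
    ultimately show ?thesis using redirect_w w by force
  next
    case (y j)
    then have "x = y j" "u = - int j" using V_nonneg[OF x] by (auto simp: doubleton_eq_iff)
    moreover have "w j \<in> nbr (y j)"
      using y y_props[of j] w_props[of j] by (simp add: nbr_def bwd_def)
    ultimately show ?thesis using redirect_y y by force
  qed (use V_nonneg[OF x] N_ge in \<open>auto simp: doubleton_eq_iff\<close>)
next
  fix u' assume "u' \<in> redirect x ` nbr x"
  then obtain u where u: "u \<in> nbr x" "u' = redirect x u" by blast
  show "u' \<in> {u. {x, u} \<in> full_edges}"
  proof (cases "{x, u} \<in> subdivided")
    case False
    then show ?thesis using u x by (auto simp: redirect_def full_edges_def chain_edge_iff)
  next
    case True
    then obtain j where j: "1 \<le> j" "j < N" "{x, u} = {w j, y j}" by (auto simp: subdivided_def)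
    then consider "x = w j" "u = y j" | "x = y j" "u = w j" by (auto simp: doubleton_eq_iff)
    then show ?thesis
    proof cases
      case 1
      then show ?thesis using u j redirect_w by (auto simp: full_edges_def)
    next
      case 2
      then show ?thesis using u j redirect_y by (auto simp: full_edges_def)
    qed
  qed
qed

text \<open>The sign of the value tells whether the edge is subdivided. A negative value
  \<open>-j\<close> determines the subdivided edge, since there is only one for each
  \<open>j\<close>.\<close>

lemma inj_on_redirect:
  assumes "x \<in> V"
  shows "inj_on (redirect x) (nbr x)"
proof (rule inj_onI)
  fix u u' assume u: "u \<in> nbr x" "u' \<in> nbr x" and eq: "redirect x u = redirect x u'"
  have neg: "redirect x z < 0 \<longleftrightarrow> {x, z} \<in> subdivided" if "z \<in> nbr x" for z
  proof (cases "{x, z} \<in> subdivided")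
    case True
    then obtain j where "1 \<le> j" "j < N" "{x, z} = {w j, y j}" by (auto simp: subdivided_def)
    then show ?thesis using True redirect_w[of j] redirect_y[of j]
      by (auto simp: doubleton_eq_iff)
  next
    case False
    have "0 \<le> z" using that V_nonneg by (auto simp: nbr_def layer_def bwd_def)
    then show ?thesis using False by (simp add: redirect_def)
  qed
  show "u = u'"
  proof (cases "{x, u} \<in> subdivided")
    case False
    then show ?thesis using neg[OF u(1)] neg[OF u(2)] eq by (simp add: redirect_def)
  next
    case True
    then have "{x, u'} \<in> subdivided" using neg[OF u(1)] neg[OF u(2)] eq by simp
    then obtain i j where ij: "1 \<le> i" "i < N" "{x, u} = {w i, y i}"
      "1 \<le> j" "j < N" "{x, u'} = {w j, y j}"
      using True by (auto simp: subdivided_def)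
    then have "i = j"
      using eq redirect_subdivided[OF ij(1-3)] redirect_subdivided[OF ij(4-6)] by simp
    then have "{x, u} = {x, u'}" using ij by simp
    then show ?thesis by (auto simp: doubleton_eq_iff)
  qed
qed

lemma card_neighbours_full: "x \<in> V \<Longrightarrow> card {u. {x, u} \<in> full_edges} = card (nbr x)"
  by (simp add: neighbours_full card_image inj_on_redirect)

section \<open>Distances from the source in a completion\<close>

definition reach :: "nat \<Rightarrow> int \<Rightarrow> bool" where
  "reach n v \<longleftrightarrow> (\<exists>xs. walk_betw full_edges s xs v \<and> walk_length xs = n)"

lemma reach_step: "reach n a \<Longrightarrow> {a, b} \<in> full_edges \<Longrightarrow> reach (Suc n) b"
  unfolding reach_def using walk_betw_snoc by blast

lemma reach_0: "reach 0 s"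
  unfolding reach_def walk_betw_def walk_length_def by (rule exI[of _ "[s]"]) simp

lemma reach_layer_1:
  assumes "x \<in> layer 1"
  shows "reach 1 x"
proof -
  have "{s, x} \<in> chain_edges"
    using assms s_in_V lay_s by (auto simp: chain_edge_iff nbr_def layer_def)
  moreover have "{s, x} \<notin> subdivided"
    using w_props y_props lay_s by (fastforce simp: subdivided_def doubleton_eq_iff)
  ultimately show ?thesis using reach_step[OF reach_0] by (auto simp: full_edges_def)
qed

text \<open>The route \<open>s\<close>, \<open>w 1\<close>, \<open>-1\<close>, \<open>-N\<close>
  reaches the hub in three edges (the case \<open>k = 0\<close>); from there it follows the attached
  path.\<close>

lemma reach_path: "reach (3 + k) (- int (N + k))" if "k \<le> r - 3"
  using that
proof (induction k)
  case 0
  have "reach 1 (w 1)" using reach_layer_1 w_layer[of 1] N_ge by simp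
  moreover have "{w 1, - int 1} \<in> full_edges" "{- int 1, - int N} \<in> full_edges"
    using N_ge full_edges_w[of 1] full_edges_hub[of 1] by simp_all
  ultimately have "reach (Suc (Suc 1)) (- int N)" using reach_step by blast
  then show ?case by (simp add: numeral_3_eq_3)
next
  case (Suc k)
  then have "{- int (N + k), - int (Suc (N + k))} \<in> full_edges"
    by (intro full_edges_path) auto
  then show ?case using reach_step Suc by fastforce
qed

lemma reach_subdivision: "\<lbrakk>1 \<le> j; j < N\<rbrakk> \<Longrightarrow> reach 4 (- int j)"
proof -
  assume j: "1 \<le> j" "j < N"
  then have "{- int N, - int j} \<in> full_edges"
    unfolding full_edges_def by (auto simp: insert_commute)
  then show ?thesis using reach_step[of 3 "- int N"] reach_path[of 0] by simp
qed

text \<open>Going through the hub, \<open>-j\<close> is reached in 4 steps, and \<open>w j\<close>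
  and \<open>y j\<close> in 5. Any other node of layer \<open>j + 1\<close> is still adjacent to
  \<open>w j\<close>, because only the edge to \<open>y j\<close> is subdivided; this gives the
  bound 6.\<close>

lemma reach_chain:
  assumes x: "x \<in> V"
  shows "\<exists>n\<le>6. reach n x"
proof -
  consider "lay x = 0" | "lay x = 1" | j where "1 \<le> j" "j < N" "lay x = Suc j"
  proof -
    assume a: "lay x = 0 \<Longrightarrow> thesis" "lay x = 1 \<Longrightarrow> thesis"
      "\<And>j. \<lbrakk>1 \<le> j; j < N; lay x = Suc j\<rbrakk> \<Longrightarrow> thesis"
    show thesis using a(1,2) a(3)[of "lay x - 1"] lay_le[OF x] by linarith
  qed
  then show ?thesis
  proof cases
    case 1
    then show ?thesis using reach_0 lay_0_iff[OF x] by blast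
  next
    case 2
    then show ?thesis using reach_layer_1[of x] x by (intro exI[of _ 1]) (auto simp: layer_def)
  next
    case (3 j)
    have "{- int j, w j} \<in> full_edges" "{- int j, y j} \<in> full_edges"
      using 3 unfolding full_edges_def by (auto simp: insert_commute)
    then have *: "reach 5 (w j)" "reach 5 (y j)"
      using reach_step[OF reach_subdivision] 3 by force+
    show ?thesis
    proof (cases "x = y j")
      case False
      have "{w j, x} \<in> chain_edges"
        using 3 x w_props[of j] by (auto simp: chain_edge_iff nbr_def layer_def)
      moreover have "{w j, x} \<notin> subdivided"
        using False 3 w_props y_props by (fastforce simp: subdivided_def doubleton_eq_iff)
      ultimately have "{w j, x} \<in> full_edges" by (auto simp: full_edges_def)
      then show ?thesis using reach_step[OF *(1)] by force
    qed (use * in \<open>auto intro: exI[of _ 5]\<close>)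
  qed
qed

lemma reach_all:
  assumes "v \<in> full_verts"
  shows "\<exists>n\<le>r. reach n v"
proof -
  consider "v \<in> V" | "- int N < v" "v \<le> -1" | "- int (N + r - 3) \<le> v" "v \<le> - int N"
    using assms unfolding full_verts_def by fastforce
  then show ?thesis
  proof cases
    case 1
    then show ?thesis using reach_chain r_ge by (meson order_trans)
  next
    case 2
    then show ?thesis using reach_subdivision[of "nat (- v)"] r_ge
      by (intro exI[of _ 4]) auto
  next
    case 3
    then show ?thesis using reach_path[of "nat (- v) - N"] r_ge
      by (intro exI[of _ "3 + (nat (- v) - N)"]) auto
  qed
qed

text \<open>A lower bound for the distance from \<open>s\<close>. Capping chain nodes at 2 keeps the
  jump at most one where subdivision nodes, also of level 2, offer a shortcut between distant
  layers; the hub has level 3.\<close>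

definition level :: "int \<Rightarrow> nat" where
  "level v = (if 0 \<le> v then min (lay v) 2 else if - int N < v then 2 else 3 + (nat (- v) - N))"

lemma level_edge:
  assumes "{a, b} \<in> full_edges"
  shows "level b \<le> Suc (level a)"
  using assms
proof (cases rule: full_edges_cases)
  case chain
  then have "a \<in> V" "b \<in> V" "lay b \<le> Suc (lay a)"
    by (auto simp: chain_edge_iff nbr_def layer_def bwd_def)
  then show ?thesis using V_nonneg by (auto simp: level_def)
next
  case (w j)
  then show ?thesis using w_props[of j] V_nonneg[of "w j"]
    by (auto simp: doubleton_eq_iff level_def)
next
  case (y j)
  then show ?thesis using y_props[of j] V_nonneg[of "y j"]
    by (auto simp: doubleton_eq_iff level_def)
next
  case (path i)
  have "level (- int i) = 3 + (i - N)" "level (- int (Suc i)) = 3 + (Suc i - N)"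
    using path N_ge by (simp_all add: level_def nat_add_distrib)
  then show ?thesis using path by (auto simp: doubleton_eq_iff)
qed (use N_ge in \<open>auto simp: doubleton_eq_iff level_def\<close>)

lemma full_graph:
  assumes e: "edges G = full_edges" and v: "verts G = full_verts"
    and p: "\<forall>v \<in> verts G. bij_betw (port G v) (neighbours G v) {..<deg G v}"
  shows "valid_graph G" "eccentricity G s = r"
proof -
  have fin: "finite (verts G)" using finite_V by (simp add: v full_verts_def)
  have walk: "\<exists>xs. walk_betw (edges G) s xs a \<and> walk_length xs \<le> r" if "a \<in> verts G" for a
    using reach_all that by (auto simp: v e reach_def)
  have "\<exists>xs. walk_betw (edges G) a xs b" if "a \<in> verts G" "b \<in> verts G" for a b
    using walk[OF that(1)] walk[OF that(2)] walk_betw_rev walk_betw_trans by blast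
  then show "valid_graph G"
    using full_edges_subset p fin by (simp add: valid_graph_def e v)
  \<comment> \<open>The far end of the attached path, whose level is \<open>3 + (r - 3) = r\<close>,
    attains the eccentricity.\<close>
  let ?z = "- int (N + (r - 3))"
  have z: "?z \<in> verts G" using r_ge N_ge by (auto simp: v full_verts_def)
  obtain xs where "walk_betw (edges G) s xs ?z" using walk[OF z] by blast
  then have "level ?z \<le> level s + distance G s ?z"
    by (rule distance_ge_potential) (use level_edge e in auto)
  moreover have "level s = 0" using s_in_V lay_s V_nonneg by (simp add: level_def)
  moreover have "level ?z = r" using N_ge r_ge by (simp add: level_def nat_add_distrib)
  ultimately have ge: "r \<le> distance G s ?z" by simp
  have le: "distance G s a \<le> r" if "a \<in> verts G" for a
    using walk[OF that] distance_le order_trans by blast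
  show "eccentricity G s = r"
    unfolding eccentricity_def
  proof (rule Max_eqI)
    show "r \<in> distance G s ` verts G" using ge le[OF z] z by (metis image_eqI le_antisym)
  qed (use fin le in auto)
qed

lemma card_full_verts: "card full_verts = card V + (N + r - 3)"
proof -
  have "V \<inter> {- int (N + r - 3) .. -1} = {}" using V_nonneg by fastforce
  then show ?thesis unfolding full_verts_def
    by (subst card_Un_disjoint) (auto simp: finite_V)
qed

lemma full_edges_unexplored: "F \<subseteq> chain_edges \<Longrightarrow> \<not> full_edges \<subseteq> F"
proof
  assume "F \<subseteq> chain_edges" "full_edges \<subseteq> F"
  moreover have "{- int 1, - int N} \<in> full_edges" using N_ge full_edges_hub[of 1] by simp
  ultimately show False using V_nonneg[of "-1"] by (auto simp: chain_edge_iff)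
qed

end

section \<open>Completions that agree with a partial exploration\<close>

context layered_chain
begin

definition ports_ok :: "int set set \<Rightarrow> (int \<Rightarrow> int \<Rightarrow> nat) \<Rightarrow> bool" where
  "ports_ok F P \<longleftrightarrow> (\<forall>x\<in>V. inj_on (P x) {u. {x, u} \<in> F} \<and>
     P x ` {u. {x, u} \<in> F} \<subseteq> {..<card (nbr x)})"

definition gaps :: "int set set \<Rightarrow> bool" where
  "gaps F \<longleftrightarrow> (\<forall>j. 1 \<le> j \<longrightarrow> j < N \<longrightarrow> (\<exists>a\<in>layer j. \<exists>b\<in>layer (Suc j). {a, b} \<notin> F))"

text \<open>This covers all that an agent confined to chain edges in \<open>F\<close> can observe.
  As \<open>{x, u}\<close> is unordered, the last clause fixes the ports at both ends of an
  edge.\<close>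

definition compat :: "port_graph \<Rightarrow> int set set \<Rightarrow> (int \<Rightarrow> int \<Rightarrow> nat) \<Rightarrow> bool" where
  "compat G F P \<longleftrightarrow> F \<subseteq> edges G \<and> (\<forall>x\<in>V. deg G x = card (nbr x)) \<and>
     (\<forall>x u. {x, u} \<in> F \<longrightarrow> port G x u = P x u)"

lemma completion_exists:
  assumes r: "6 \<le> r" and F: "F \<subseteq> chain_edges" and P: "ports_ok F P" and gaps: "gaps F"
  obtains G where "valid_graph G" "s \<in> verts G" "eccentricity G s = r" "compat G F P"
    "\<not> edges G \<subseteq> F" "card (verts G) = card V + (N + r - 3)"
proof -
  have "\<forall>j. \<exists>p. 1 \<le> j \<longrightarrow> j < N \<longrightarrow> fst p \<in> layer j \<and> snd p \<in> layer (Suc j) \<and> {fst p, snd p} \<notin> F"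
    using gaps unfolding gaps_def by (metis fst_conv snd_conv)
  then obtain p where p: "\<And>j. \<lbrakk>1 \<le> j; j < N\<rbrakk> \<Longrightarrow>
      fst (p j) \<in> layer j \<and> snd (p j) \<in> layer (Suc j) \<and> {fst (p j), snd (p j)} \<notin> F"
    by (metis (no_types, lifting))
  interpret completed_chain V lay s m N r "\<lambda>j. fst (p j)" "\<lambda>j. snd (p j)"
    by unfold_locales (use r p in auto)
  have "F \<inter> subdivided = {}" using p by (auto simp: subdivided_def)
  then have Ff: "F \<subseteq> full_edges" using F unfolding full_edges_def by blast
  define n where "n v = {u. {v, u} \<in> full_edges}" for v
  have finn: "finite (n v)" for v
  proof (rule finite_subset)
    show "n v \<subseteq> full_verts"
      unfolding n_def using full_edges_subset by (fastforce simp: doubleton_eq_iff)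
    show "finite full_verts" using finite_V by (simp add: full_verts_def)
  qed
  have "\<exists>g. bij_betw g (n v) {..<card (n v)} \<and> (\<forall>u\<in>{u. {v, u} \<in> F}. g u = P v u)" for v
  proof (rule bij_betw_extend[OF finn])
    show "{u. {v, u} \<in> F} \<subseteq> n v" using Ff by (auto simp: n_def)
    \<comment> \<open>Outside \<open>V\<close> no port is prescribed; inside \<open>V\<close> the
      degree in the completion equals the degree in the chain, so the bound in
      \<open>ports_ok\<close> is the right one.\<close>
    have "v \<in> V \<or> {u. {v, u} \<in> F} = {}" using F by (auto simp: chain_edge_iff)
    then show "inj_on (P v) {u. {v, u} \<in> F}" "P v ` {u. {v, u} \<in> F} \<subseteq> {..<card (n v)}"
      using P card_neighbours_full[of v] by (auto simp: ports_ok_def n_def image_subset_iff)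
  qed
  then obtain q where q: "\<And>v. bij_betw (q v) (n v) {..<card (n v)}"
    "\<And>v u. {v, u} \<in> F \<Longrightarrow> q v u = P v u"
    by (metis mem_Collect_eq)
  define G where "G = \<lparr>verts = full_verts, edges = full_edges, port = q\<rparr>"
  have nG: "neighbours G v = n v" for v by (simp add: neighbours_def G_def n_def)
  show thesis
  proof (rule that)
    show "valid_graph G" "eccentricity G s = r"
      using full_graph[of G] q(1) by (auto simp: G_def deg_def nG[unfolded G_def])
    show "s \<in> verts G" using s_in_V by (simp add: G_def full_verts_def)
    show "compat G F P"
      using Ff q(2) card_neighbours_full
      by (auto simp: compat_def deg_def nG) (auto simp: G_def n_def)
    show "\<not> edges G \<subseteq> F" using full_edges_unexplored[OF F] by (simp add: G_def)
    show "card (verts G) = card V + (N + r - 3)" using card_full_verts by (simp add: G_def)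
  qed
qed

section \<open>Double counting of traversed edges between consecutive layers\<close>

definition fexp :: "int set set \<Rightarrow> int \<Rightarrow> nat" where
  "fexp F x = card {u \<in> layer (Suc (lay x)). {x, u} \<in> F}"

definition bexp :: "int set set \<Rightarrow> int \<Rightarrow> nat" where
  "bexp F x = card {u \<in> bwd x. {x, u} \<in> F}"

definition crossing :: "int set set \<Rightarrow> nat \<Rightarrow> nat" where
  "crossing F j = card {(a, b). a \<in> layer j \<and> b \<in> layer (Suc j) \<and> {a, b} \<in> F}"

lemma sum_fexp: "(\<Sum>x\<in>layer j. fexp F x) = crossing F j"
proof -
  have "(\<Sum>x\<in>layer j. fexp F x) = (\<Sum>x\<in>layer j. card {u \<in> layer (Suc j). {x, u} \<in> F})"
    by (rule sum.cong) (auto simp: fexp_def layer_def)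
  also have "\<dots> = card (SIGMA x:layer j. {u \<in> layer (Suc j). {x, u} \<in> F})"
    by simp
  also have "(SIGMA x:layer j. {u \<in> layer (Suc j). {x, u} \<in> F}) =
      {(a, b). a \<in> layer j \<and> b \<in> layer (Suc j) \<and> {a, b} \<in> F}" by auto
  finally show ?thesis by (simp add: crossing_def)
qed

lemma sum_bexp: "(\<Sum>x\<in>layer (Suc j). bexp F x) = crossing F j"
proof -
  have "(\<Sum>x\<in>layer (Suc j). bexp F x) = (\<Sum>x\<in>layer (Suc j). card {u \<in> layer j. {u, x} \<in> F})"
    by (rule sum.cong) (auto simp: bexp_def layer_def bwd_def insert_commute intro: arg_cong[of _ _ card])
  also have "\<dots> = card (SIGMA x:layer (Suc j). {u \<in> layer j. {u, x} \<in> F})"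
    by simp
  also have "\<dots> = card ((\<lambda>(a, b). (b, a)) ` (SIGMA x:layer (Suc j). {u \<in> layer j. {u, x} \<in> F}))"
    by (rule card_image[symmetric]) (auto simp: inj_on_def)
  also have "(\<lambda>(a, b). (b, a)) ` (SIGMA x:layer (Suc j). {u \<in> layer j. {u, x} \<in> F}) =
      {(a, b). a \<in> layer j \<and> b \<in> layer (Suc j) \<and> {a, b} \<in> F}" by (auto simp: image_iff)
  finally show ?thesis by (simp add: crossing_def)
qed

text \<open>Of the \<open>m * m\<close> pairs, at most one is the edge \<open>e\<close>: an
  unordered pair can be ordered from layer \<open>j\<close> to layer \<open>j + 1\<close> in only
  one way.\<close>

lemma crossing_ge_if_filled:
  assumes j: "1 \<le> j" "j < N"
    and filled: "\<forall>a\<in>layer j. \<forall>b\<in>layer (Suc j). {a, b} \<in> insert e F"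
  shows "m * m \<le> Suc (crossing F j)"
proof -
  let ?A = "{(a, b). a \<in> layer j \<and> b \<in> layer (Suc j) \<and> {a, b} \<in> F}"
  let ?B = "{(a, b). a \<in> layer j \<and> b \<in> layer (Suc j) \<and> {a, b} = e}"
  have fin: "finite ?A" "finite ?B"
    by (auto intro: finite_subset[of _ "layer j \<times> layer (Suc j)"])
  have "card ?B \<le> 1"
    unfolding One_nat_def card_le_Suc0_iff_eq[OF fin(2)]
    by (auto simp: layer_def doubleton_eq_iff)
  moreover have "m * m = card (layer j \<times> layer (Suc j))"
    using j card_layer by (simp add: card_cartesian_product)
  moreover have "card (layer j \<times> layer (Suc j)) \<le> card (?A \<union> ?B)"
    using filled fin by (intro card_mono) auto
  ultimately show ?thesis using card_Un_le[of ?A ?B] by (simp add: crossing_def)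
qed

end

section \<open>The adversary\<close>

text \<open>By \<open>N_bound\<close>, the last layer lies just too deep to be joined to
  \<open>s\<close> by a chain walk within the distance constraint.\<close>

locale adversary = layered_chain +
  fixes A :: algorithm and \<alpha> :: real and r :: nat
  assumes solves: "solves A \<alpha> r"
    and r_ge: "6 \<le> r"
    and N_bound: "\<And>n. real n \<le> (1 + \<alpha>) * real r \<Longrightarrow> n < N"
begin

text \<open>Quantifying over all compatible graphs leaves the graph open: the history is a genuine
  run on whichever completion is chosen later.\<close>

definition consistent :: "history \<Rightarrow> int \<Rightarrow> (int \<Rightarrow> int \<Rightarrow> nat) \<Rightarrow> bool" where
  "consistent h v P \<longleftrightarrow> (\<forall>G. compat G (traversed_edges s h) P \<longrightarrow> execution A G s h v)"

text \<open>\<open>R x\<close> counts the departures from \<open>x\<close> along edges that had been traversed before.\<close>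

definition good :: "history \<Rightarrow> int \<Rightarrow> (int \<Rightarrow> int \<Rightarrow> nat) \<Rightarrow> (int \<Rightarrow> nat) \<Rightarrow> bool" where
  "good h v P R \<longleftrightarrow>
     v \<in> V \<and> lay v < N \<and> consistent h v P \<and> last (visited_nodes s h) = v \<and>
     traversed_edges s h \<subseteq> chain_edges \<and>
     ports_ok (traversed_edges s h) P \<and>
     gaps (traversed_edges s h) \<and>
     (\<forall>x u. {x, u} \<in> traversed_edges s h \<longrightarrow> lay x < N) \<and>
     card (traversed_edges s h) + sum R V = length h \<and>
     (\<forall>x\<in>V. 1 \<le> lay x \<longrightarrow> lay x < N \<longrightarrow>
        bexp (traversed_edges s h) x \<le> fexp (traversed_edges s h) x + R x + of_bool (x = v))"

lemma instance_exists:
  assumes "consistent h v P" "traversed_edges s h \<subseteq> chain_edges"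
    "ports_ok (traversed_edges s h) P" "gaps (traversed_edges s h)"
  obtains G where "(G, s, \<alpha>) \<in> instances \<alpha> r" "valid_graph G" "s \<in> verts G"
    "compat G (traversed_edges s h) P"
    "\<not> edges G \<subseteq> traversed_edges s h" "card (verts G) = card V + (N + r - 3)"
    "execution A G s h v" "explores A G s" "respects_distance A G s ((1 + \<alpha>) * real r)"
proof -
  obtain G where G: "valid_graph G" "s \<in> verts G" "eccentricity G s = r"
    "compat G (traversed_edges s h) P" "\<not> edges G \<subseteq> traversed_edges s h"
    "card (verts G) = card V + (N + r - 3)"
    using completion_exists[OF r_ge assms(2-4)] .
  then have "(G, s, \<alpha>) \<in> instances \<alpha> r" by (simp add: instances_def)
  then show thesis using that G solves assms(1) by (simp add: solves_def consistent_def)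
qed

text \<open>On some completion the algorithm must know a short walk back to \<open>s\<close>. This
  walk uses only traversed edges, all of them chain edges, so each of its steps changes the layer by
  at most one.\<close>

lemma lay_bound:
  assumes "consistent h v P" "traversed_edges s h \<subseteq> chain_edges"
    "ports_ok (traversed_edges s h) P" "gaps (traversed_edges s h)"
  shows "lay v < N"
proof -
  obtain G where "execution A G s h v" "respects_distance A G s ((1 + \<alpha>) * real r)"
    using instance_exists[OF assms] .
  then obtain xs where xs: "walk_betw (traversed_edges s h) v xs s"
    "real (walk_length xs) \<le> (1 + \<alpha>) * real r"
    by (auto simp: respects_distance_def)
  have "lay v \<le> lay s + walk_length (rev xs)"
    by (rule walk_potential[OF walk_betw_rev[OF xs(1)]])
      (use assms(2) in \<open>fastforce simp: chain_edge_iff nbr_def layer_def bwd_def\<close>)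
  then show ?thesis using N_bound[OF xs(2)] lay_s by (simp add: walk_length_def)
qed

lemma crossing_le_repeats:
  assumes g: "good h v P R" and i: "i \<le> N" "1 \<le> i"
  shows "crossing (traversed_edges s h) (i - 1) \<le> 
      (\<Sum>x | x \<in> V \<and> i \<le> lay x. R x) + of_bool (i \<le> lay v)"
  using i
proof (induction i rule: inc_induct)
  \<comment> \<open>Both ends of a traversed edge lie below layer \<open>N\<close>, so nothing has
    crossed into that layer.\<close>
  case base
  have "{(a, b). a \<in> layer (N - 1) \<and> b \<in> layer (Suc (N - 1)) \<and> {a, b} \<in> traversed_edges s h} = {}"
    using g N_ge by (fastforce simp: good_def layer_def insert_commute)
  then show ?case unfolding crossing_def by (simp only: card.empty zero_le)
next
  case (step i)
  let ?F = "traversed_edges s h"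
  \<comment> \<open>Summing the balance clause of \<open>good\<close> over layer \<open>i\<close>
    bounds the crossings into the layer by those out of it, the repeats in it and the presence of
    the agent.\<close>
  have "crossing ?F (i - 1) = (\<Sum>x\<in>layer i. bexp ?F x)"
    using sum_bexp[of ?F "i - 1"] step by simp
  also have "\<dots> \<le> (\<Sum>x\<in>layer i. fexp ?F x + R x + of_bool (x = v))"
    using g step by (intro sum_mono) (auto simp: good_def layer_def)
  also have "\<dots> = crossing ?F i + sum R (layer i) + (\<Sum>x\<in>layer i. of_bool (x = v))"
    by (simp add: sum.distrib sum_fexp)
  also have "(\<Sum>x\<in>layer i. of_bool (x = v)) = (of_bool (lay v = i) :: nat)"
    using g by (auto simp: good_def layer_def of_bool_def finite_V)
  also have "crossing ?F i \<le> (\<Sum>x | x \<in> V \<and> Suc i \<le> lay x. R x) + of_bool (Suc i \<le> lay v)"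
    using step.IH by simp
  also have "(\<Sum>x | x \<in> V \<and> Suc i \<le> lay x. R x) + of_bool (Suc i \<le> lay v) + sum R (layer i)
      + of_bool (lay v = i) = (\<Sum>x | x \<in> V \<and> i \<le> lay x. R x) + of_bool (i \<le> lay v)"
  proof -
    have "{x \<in> V. i \<le> lay x} = {x \<in> V. Suc i \<le> lay x} \<union> layer i" by (auto simp: layer_def)
    then have "(\<Sum>x | x \<in> V \<and> i \<le> lay x. R x) = (\<Sum>x | x \<in> V \<and> Suc i \<le> lay x. R x) + sum R (layer i)"
      by (simp, subst sum.union_disjoint) (auto simp: finite_V layer_def)
    then show ?thesis by auto
  qed
  finally show ?case by simp
qed

text \<open>If \<open>e\<close> closed the last gap of a pair of layers, at least
  \<open>m * m - 1\<close> crossings would precede it, whereas \<open>crossing_le_repeats\<close>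
  allows at most \<open>sum R V + 1\<close>.\<close>

lemma gaps_insert:
  assumes g: "good h v P R" and small: "sum R V + 2 < m * m"
  shows "gaps (insert e (traversed_edges s h))"
  unfolding gaps_def
proof (intro allI impI, rule ccontr)
  fix j assume j: "1 \<le> j" "j < N"
    and "\<not> (\<exists>a\<in>layer j. \<exists>b\<in>layer (Suc j). {a, b} \<notin> insert e (traversed_edges s h))"
  then have "m * m \<le> Suc (crossing (traversed_edges s h) j)"
    by (intro crossing_ge_if_filled[of j e]) auto
  also have "crossing (traversed_edges s h) j \<le> 
      (\<Sum>x | x \<in> V \<and> Suc j \<le> lay x. R x) + of_bool (Suc j \<le> lay v)"
    using crossing_le_repeats[OF g, of "Suc j"] j by simp
  also have "\<dots> \<le> sum R V + 1"
    by (intro add_mono sum_mono2) (auto simp: finite_V)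
  finally show False using small by simp
qed

section \<open>Prolonging the exploration by one traversal\<close>

lemma step_old:
  assumes g: "good h v P R" and A: "A (s, card (nbr s)) h = Some (P v u)"
    and u: "{v, u} \<in> traversed_edges s h"
  shows "good (h @ [(P v u, P u v, u, card (nbr u))]) u P (R(v := Suc (R v)))"
proof -
  let ?h = "h @ [(P v u, P u v, u, card (nbr u))]"
  have F: "traversed_edges s ?h = traversed_edges s h"
    using g u by (auto simp: traversed_edges_snoc good_def)
  have "{v, u} \<in> chain_edges" using g u by (auto simp: good_def)
  then have uV: "u \<in> V" "v \<in> V" "u \<noteq> v"
    unfolding chain_edge_iff by (auto simp: nbr_def layer_def bwd_def)
  have "consistent ?h u P"
    unfolding consistent_def F
  proof (intro allI impI)
    fix G assume c: "compat G (traversed_edges s h) P"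
    then have "execution A G s h v" using g by (auto simp: good_def consistent_def)
    moreover have "port G v u = P v u" "port G u v = P u v" "deg G u = card (nbr u)"
      "u \<in> neighbours G v" "deg G s = card (nbr s)"
      using c u uV s_in_V by (auto simp: compat_def neighbours_def insert_commute)
    ultimately show "execution A G s ?h u" using execution.move[of A G s h v "P v u" u] A by simp
  qed
  moreover have "lay u < N" using g u by (auto simp: good_def insert_commute)
  moreover have "sum (R(v := Suc (R v))) V = Suc (sum R V)"
    using uV finite_V by (simp add: sum.remove[of V v])
  moreover have "visited_nodes s ?h = visited_nodes s h @ [u]" by (simp add: visited_nodes_def)
  \<comment> \<open>At \<open>v\<close> the increment of \<open>R\<close> replaces the unit that the
    departing agent takes away.\<close>
  moreover have "bexp (traversed_edges s h) x \<le>
      fexp (traversed_edges s h) x + (R(v := Suc (R v))) x + of_bool (x = u)"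
    if "x \<in> V" "1 \<le> lay x" "lay x < N" for x
    using g that unfolding good_def by (cases "x = v") auto
  ultimately show ?thesis using g uV unfolding good_def F by simp
qed

lemma step_new:
  assumes g: "good h v P R" and small: "sum R V + 2 < m * m"
    and A: "A (s, card (nbr s)) h = Some p"
    and p: "p < card (nbr v)" "p \<notin> P v ` {u. {v, u} \<in> traversed_edges s h}"
    and u: "u \<in> nbr v" "{v, u} \<notin> traversed_edges s h"
    and fwd: "u \<in> bwd v \<Longrightarrow> \<forall>z\<in>layer (Suc (lay v)). {v, z} \<in> traversed_edges s h"
  shows "\<exists>e P'. good (h @ [e]) u P' R"
proof -
  let ?F = "traversed_edges s h"
  have v: "v \<in> V" "lay v < N" "?F \<subseteq> chain_edges" "ports_ok ?F P" "last (visited_nodes s h) = v"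
    using g by (auto simp: good_def)
  have uV: "u \<in> V" "u \<noteq> v" and vu: "v \<in> nbr u"
    using u v by (auto simp: nbr_def layer_def bwd_def)
  have sub: "{z. {u, z} \<in> ?F} \<subseteq> nbr u - {v}"
  proof
    fix z assume z: "z \<in> {z. {u, z} \<in> ?F}"
    then have "{u, z} \<in> chain_edges" using v(3) by blast
    then have "z \<in> nbr u" unfolding chain_edge_iff by simp
    moreover have "z \<noteq> v" using z u(2) by (auto simp: insert_commute)
    ultimately show "z \<in> nbr u - {v}" by simp
  qed
  \<comment> \<open>The edge from \<open>u\<close> to \<open>v\<close> is still untraversed, so
    fewer ports are in use at \<open>u\<close> than its degree, and a free arrival port
    \<open>q\<close> exists.\<close>
  then have "finite {z. {u, z} \<in> ?F}" using finite_subset finite_Diff finite_nbr by metis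
  then have "card (P u ` {z. {u, z} \<in> ?F}) \<le> card (nbr u - {v})"
    using sub by (meson card_image_le card_mono finite_Diff finite_nbr le_trans)
  also have "\<dots> < card {..<card (nbr u)}"
    using vu by (metis card_Diff1_less card_lessThan finite_nbr)
  finally obtain q where q: "q < card (nbr u)" "q \<notin> P u ` {z. {u, z} \<in> ?F}"
    by (metis card_mono finite_imageI \<open>finite {z. {u, z} \<in> ?F}\<close> lessThan_iff not_le subsetI)
  define P' where "P' = P(v := (P v)(u := p), u := (P u)(v := q))"
  define h' where "h' = h @ [(p, q, u, card (nbr u))]"
  have F': "traversed_edges s h' = insert {v, u} ?F"
    by (simp add: h'_def traversed_edges_snoc v)
  have P'_old: "P' x z = P x z" if "{x, z} \<in> ?F" for x z
    using that u uV by (auto simp: P'_def insert_commute)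
  have P'_new: "P' v u = p" "P' u v = q" using uV by (auto simp: P'_def)
  have chain: "insert {v, u} ?F \<subseteq> chain_edges" using v u by (simp add: chain_edge_iff)
  have ports: "ports_ok (insert {v, u} ?F) P'"
    unfolding ports_ok_def
  proof
    fix x assume x: "x \<in> V"
    let ?n = "{z. {x, z} \<in> ?F}"
    have old: "inj_on (P' x) ?n" "P' x ` ?n = P x ` ?n" "P' x ` ?n \<subseteq> {..<card (nbr x)}"
      using v(4) x P'_old[of x] by (auto simp: ports_ok_def inj_on_def)
    consider "x = v" | "x = u" | "x \<noteq> v" "x \<noteq> u" by blast
    then show "inj_on (P' x) {z. {x, z} \<in> insert {v, u} ?F} \<and>
        P' x ` {z. {x, z} \<in> insert {v, u} ?F} \<subseteq> {..<card (nbr x)}"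
    proof cases
      case 1
      then have "{z. {x, z} \<in> insert {v, u} ?F} = insert u ?n"
        by (auto simp: doubleton_eq_iff)
      then show ?thesis using old 1 P'_new p by simp blast
    next
      case 2
      then have "{z. {x, z} \<in> insert {v, u} ?F} = insert v ?n"
        by (auto simp: doubleton_eq_iff)
      then show ?thesis using old 2 P'_new q by simp blast
    next
      case 3
      then have "{z. {x, z} \<in> insert {v, u} ?F} = ?n" by (auto simp: doubleton_eq_iff)
      then show ?thesis using old by simp
    qed
  qed
  have gaps: "gaps (insert {v, u} ?F)" by (rule gaps_insert[OF g small])
  have cons: "consistent h' u P'"
    unfolding consistent_def F'
  proof (intro allI impI)
    fix G assume c: "compat G (insert {v, u} ?F) P'"
    then have "compat G ?F P" using P'_old by (auto simp: compat_def)
    then have "execution A G s h v" using g by (auto simp: good_def consistent_def)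
    moreover have "port G v u = p" "port G u v = q" "deg G u = card (nbr u)"
      "u \<in> neighbours G v" "deg G s = card (nbr s)"
      using c uV s_in_V P'_new by (auto simp: compat_def neighbours_def insert_commute)
    ultimately show "execution A G s h' u"
      using execution.move[of A G s h v p u] A by (simp add: h'_def)
  qed
  \<comment> \<open>The extended history still admits a completion, so the move cannot have led into
    layer \<open>N\<close>.\<close>
  have lay_u: "lay u < N" by (rule lay_bound[OF cons]) (use F' chain ports gaps in simp_all)
  have bal: "bexp (insert {v, u} ?F) x \<le> fexp (insert {v, u} ?F) x + R x + of_bool (x = u)"
    if x: "x \<in> V" "1 \<le> lay x" "lay x < N" for x
  proof -
    have old: "bexp ?F x \<le> fexp ?F x + R x + of_bool (x = v)"
      using g x by (auto simp: good_def)
    have f_mono: "fexp ?F x \<le> fexp (insert {v, u} ?F) x"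
      unfolding fexp_def by (rule card_mono) auto
    have b_same: "bexp (insert {v, u} ?F) x = bexp ?F x" if "x \<noteq> u" "x = v \<Longrightarrow> u \<notin> bwd v"
      unfolding bexp_def using that by (intro arg_cong[of _ _ card]) (auto simp: doubleton_eq_iff)
    consider "x = u" | "x = v" "u \<in> bwd v" | "x = v" "u \<notin> bwd v" | "x \<noteq> u" "x \<noteq> v" by blast
    then show ?thesis
    proof cases
      case 1
      have "bexp (insert {v, u} ?F) x \<le> card (insert v {z \<in> bwd x. {x, z} \<in> ?F})"
        unfolding bexp_def using 1 by (intro card_mono) (auto simp: doubleton_eq_iff)
      also have "\<dots> \<le> Suc (bexp ?F x)" by (simp add: bexp_def card_insert_if)
      finally show ?thesis using old f_mono 1 uV by simp
    next
      \<comment> \<open>Departure backward: all \<open>m\<close> forward edges at \<open>v\<close>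
        have been traversed, and there are at most \<open>m\<close> backward ones, so the balance
        holds without the unit for the agent.\<close>
      case 2
      have "{z \<in> layer (Suc (lay v)). {v, z} \<in> insert {v, u} ?F} = layer (Suc (lay v))"
        using fwd[OF 2(2)] by auto
      then have "fexp (insert {v, u} ?F) v = m" using v card_layer by (simp add: fexp_def)
      moreover have "bexp (insert {v, u} ?F) v \<le> m"
      proof -
        obtain i where i: "lay v = Suc i" using x 2 by (cases "lay v") auto
        then have b: "bwd v = layer i" by (auto simp: bwd_def layer_def)
        have "card (layer i) \<le> m"
        proof (cases i)
          case 0
          then show ?thesis using layer_0 m_ge by (simp add: layer_def)
        qed (use i v card_layer in auto)
        then show ?thesis unfolding bexp_def b
          by (rule le_trans[rotated]) (auto intro: card_mono)
      qed
      ultimately show ?thesis using 2 by simp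
    next
      \<comment> \<open>Departure forward: the new forward edge makes up for the unit that the agent
        takes away.\<close>
      case 3
      then have uf: "u \<in> layer (Suc (lay v))" using u by (simp add: nbr_def)
      have "{z \<in> layer (Suc (lay v)). {v, z} \<in> insert {v, u} ?F} =
          insert u {z \<in> layer (Suc (lay v)). {v, z} \<in> ?F}"
        using uf by (auto simp: doubleton_eq_iff)
      then have "fexp (insert {v, u} ?F) v = Suc (fexp ?F v)"
        using u by (simp add: fexp_def)
      then show ?thesis using old b_same 3 uV by simp
    next
      case 4
      then show ?thesis using old f_mono b_same by simp
    qed
  qed
  have "good h' u P' R"
    unfolding good_def F'
  proof (intro conjI)
    show "\<forall>x z. {x, z} \<in> insert {v, u} ?F \<longrightarrow> lay x < N"
      using g lay_u v(2) by (auto simp: good_def doubleton_eq_iff)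
    show "card (insert {v, u} ?F) + sum R V = length h'"
      using g u by (simp add: good_def h'_def)
  qed (use uV lay_u cons chain ports gaps bal in \<open>auto simp: h'_def visited_nodes_def\<close>)
  then show ?thesis unfolding h'_def by blast
qed

section \<open>Playing the adversary until the repeats are numerous\<close>

lemma good_start: "good [] s P (\<lambda>_. 0)"
proof -
  have "gaps {}"
    unfolding gaps_def
  proof (intro allI impI)
    fix j assume j: "1 \<le> j" "j < N"
    then have "layer j \<noteq> {}" "layer (Suc j) \<noteq> {}"
      using card_layer[of j] card_layer[of "Suc j"] m_ge by auto
    then show "\<exists>a\<in>layer j. \<exists>b\<in>layer (Suc j). {a, b} \<notin> {}" by blast
  qed
  then show ?thesis
    using s_in_V lay_s N_ge
    by (auto simp: good_def traversed_edges_Nil visited_nodes_def consistent_def ports_ok_def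
        bexp_def intro: execution.start)
qed

text \<open>A completion serves only to obtain the next port, and is then discarded. A port already
  assigned means an old edge; otherwise the adversary picks an untraversed edge, forward if
  possible.\<close>

lemma good_step:
  assumes g: "good h v P R" and small: "sum R V + 2 < m * m"
  shows "\<exists>e v' P' R'. good (h @ [e]) v' P' R'"
proof -
  let ?F = "traversed_edges s h"
  have *: "consistent h v P" "?F \<subseteq> chain_edges" "ports_ok ?F P" "gaps ?F" "v \<in> V"
    using g by (auto simp: good_def)
  obtain G where G: "valid_graph G" "s \<in> verts G" "compat G ?F P"
    "\<not> edges G \<subseteq> ?F" "execution A G s h v" "explores A G s"
    using instance_exists[OF *(1-4)] .
  obtain u where u: "u \<in> neighbours G v" "A (s, deg G s) h = Some (port G v u)"
    using explores_next_port[OF G(1,2,6,5,4)] .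
  define p where "p = port G v u"
  have degs: "deg G s = card (nbr s)" "deg G v = card (nbr v)"
    using G(3) * s_in_V by (auto simp: compat_def)
  have A: "A (s, card (nbr s)) h = Some p" using u degs by (simp add: p_def)
  have "v \<in> verts G" using execution_in_verts[OF G(1,2,5)] .
  then have "bij_betw (port G v) (neighbours G v) {..<deg G v}"
    using G(1) unfolding valid_graph_def by blast
  then have p: "p < card (nbr v)"
    using bij_betwE u(1) degs(2) by (fastforce simp: p_def)
  show ?thesis
  proof (cases "p \<in> P v ` {u. {v, u} \<in> ?F}")
    case True
    then show ?thesis using step_old[OF g] A by blast
  next
    case False
    \<comment> \<open>If all edges at \<open>v\<close> had been traversed, the injective numbering
      would have used up every port below the degree, including \<open>p\<close>.\<close>
    have "\<exists>z\<in>nbr v. {v, z} \<notin> ?F"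
    proof (rule ccontr)
      assume "\<not> ?thesis"
      then have "{u. {v, u} \<in> ?F} = nbr v"
        using * by (auto simp: chain_edge_iff)
      then have "inj_on (P v) (nbr v)" "P v ` nbr v \<subseteq> {..<card (nbr v)}"
        using * unfolding ports_ok_def by metis+
      then have "P v ` nbr v = {..<card (nbr v)}"
        by (simp add: card_image card_subset_eq)
      then show False using False p \<open>{u. {v, u} \<in> ?F} = nbr v\<close> by auto
    qed
    then obtain z where z: "z \<in> nbr v" "{v, z} \<notin> ?F" by blast
    show ?thesis
    proof (cases "\<exists>z'\<in>layer (Suc (lay v)). {v, z'} \<notin> ?F")
      case True
      then obtain z' where "z' \<in> layer (Suc (lay v))" "{v, z'} \<notin> ?F" by blast
      moreover from this have "z' \<in> nbr v" "z' \<notin> bwd v"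
        by (auto simp: nbr_def layer_def bwd_def)
      ultimately show ?thesis using step_new[OF g small A p False, of z'] by blast
    next
      case nf: False
      then show ?thesis using step_new[OF g small A p False z] by blast
    qed
  qed
qed

lemma good_large: "\<exists>h v P R. good h v P R \<and> m * m \<le> sum R V + 2"
proof (rule ccontr)
  assume none: "\<not> ?thesis"
  have "\<exists>h v P R. good h v P R \<and> length h = n" for n
  proof (induction n)
    case 0
    then show ?case using good_start by (metis list.size(3))
  next
    case (Suc n)
    then obtain h v P R where h: "good h v P R" "length h = n" by blast
    then have "sum R V + 2 < m * m" using none by (meson not_le)
    then show ?case using good_step[OF h(1)] h(2) by (metis length_append_singleton)
  qed
  \<comment> \<open>The length is the number of distinct traversed edges plus the number of repeats,
    so a history this long contains at least \<open>m * m\<close> repeats.\<close>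
  then obtain h v P R where h: "good h v P R" "length h = card chain_edges + m * m" by blast
  then have "card (traversed_edges s h) \<le> card chain_edges"
    by (intro card_mono finite_chain_edges) (simp add: good_def)
  then have "m * m \<le> sum R V + 2" using h by (simp add: good_def)
  then show False using none h by blast
qed

lemma expensive_instance:
  obtains G where "(G, s, \<alpha>) \<in> instances \<alpha> r" "card (verts G) = card V + (N + r - 3)"
    "int (m * m) - 2 \<le> penalty A G s"
proof -
  obtain h v P R where h: "good h v P R" "m * m \<le> sum R V + 2" using good_large by blast
  then have *: "consistent h v P" "traversed_edges s h \<subseteq> chain_edges"
    "ports_ok (traversed_edges s h) P" "gaps (traversed_edges s h)"
    "card (traversed_edges s h) + sum R V = length h"
    by (auto simp: good_def)
  obtain G where G: "(G, s, \<alpha>) \<in> instances \<alpha> r" "valid_graph G" "s \<in> verts G"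
    "\<not> edges G \<subseteq> traversed_edges s h" "card (verts G) = card V + (N + r - 3)"
    "execution A G s h v" "explores A G s"
    using instance_exists[OF *(1-4)] .
  have "int (m * m) - 2 \<le> int (length h) - int (card (traversed_edges s h))"
    using *(5) h(2) by linarith
  then show thesis using that G penalty_ge_prefix[OF G(2,3,7,6,4)] by force
qed

end

section \<open>Choice of parameters and final estimate\<close>

theorem theorem1:
  fixes \<alpha> :: real and r :: nat and A :: algorithm
  assumes "\<alpha> > 0" and "r \<ge> 6"
    and "solves A \<alpha> r"
  shows "\<forall>k::nat. k > 1 \<longrightarrow>
    (\<exists>G s. (G, s, \<alpha>) \<in> instances \<alpha> r \<and>
       card (verts G) \<ge> k \<and>
       real_of_int (penalty A G s) \<ge>
         (real (card (verts G)) /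
           (16 * (2 * real_of_int \<lfloor>(1 + \<alpha>) * real r\<rfloor> + 3)))\<^sup>2)"
proof (intro allI impI)
  fix k :: nat assume k: "k > 1"
  define D where "D = nat \<lfloor>(1 + \<alpha>) * real r\<rfloor>"
  have "real r \<le> (1 + \<alpha>) * real r" using assms by (simp add: distrib_right)
  then have D: "r \<le> D" "\<lfloor>(1 + \<alpha>) * real r\<rfloor> = int D" unfolding D_def by linarith+
  define N where "N = Suc D"
  \<comment> \<open>The layers are blocks of \<open>k\<close> consecutive integers, so
    \<open>m = k\<close>. Starting at \<open>k - 1\<close> leaves just one element in block 0,
    namely the source.\<close>
  define V where "V = {int k - 1 ..< int k * (int N + 1)}"
  define lay where "lay x = nat (x div int k)" for x
  have lay_iff: "lay x = j \<longleftrightarrow> int k * int j \<le> x \<and> x < int k * (int j + 1)" if "0 \<le> x" for x j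
  proof -
    have "lay x = j \<longleftrightarrow> x div int k = int j"
      using that k by (auto simp: lay_def pos_imp_zdiv_nonneg_iff)
    also have "\<dots> \<longleftrightarrow> int k * int j \<le> x \<and> x < int k * (int j + 1)"
    proof
      assume "x div int k = int j"
      then have "int k * int j + x mod int k = x" by (metis mult_div_mod_eq)
      then show "int k * int j \<le> x \<and> x < int k * (int j + 1)"
        using k pos_mod_bound[of "int k" x] pos_mod_sign[of "int k" x]
        unfolding distrib_left by linarith
    next
      assume "int k * int j \<le> x \<and> x < int k * (int j + 1)"
      then show "x div int k = int j"
        by (intro int_div_pos_eq[of _ _ _ "x - int k * int j"]) (auto simp: distrib_left)
    qed
    finally show ?thesis .
  qed
  have nonneg: "0 \<le> x" if "x \<in> V" for x using that k by (simp add: V_def)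
  have layers: "{x \<in> V. lay x = j} = {int k * int j ..< int k * (int j + 1)}"
    if j: "1 \<le> j" "j \<le> N" for j
  proof -
    have "int k * 1 \<le> int k * int j" "int k * (int j + 1) \<le> int k * (int N + 1)"
      using j by (intro mult_left_mono; simp)+
    then have "{int k * int j ..< int k * (int j + 1)} \<subseteq> V" by (auto simp: V_def)
    moreover have "lay x = j \<longleftrightarrow> x \<in> {int k * int j ..< int k * (int j + 1)}" if "x \<in> V" for x
      using lay_iff[OF nonneg[OF that]] by simp
    ultimately show ?thesis by blast
  qed
  interpret adversary V lay "int k - 1" k N A \<alpha> r
  proof
    show "finite V" by (simp add: V_def)
    show "lay x \<le> N" if "x \<in> V" for x
    proof -
      have "int k * int (lay x) \<le> x" using lay_iff[OF nonneg[OF that], of "lay x"] by simp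
      also have "x < int k * (int N + 1)" using that by (simp add: V_def)
      finally show ?thesis using k by (simp add: mult_less_cancel_left_pos)
    qed
    have "int k * 1 \<le> int k * (int N + 1)" by (intro mult_left_mono) auto
    then have "int k - 1 < int k * (int N + 1)" by linarith
    then show "{x \<in> V. lay x = 0} = {int k - 1}"
      using lay_iff[of _ 0] nonneg k by (auto simp: V_def)
    show "card {x \<in> V. lay x = j} = k" if "1 \<le> j" "j \<le> N" for j
      by (simp add: layers[OF that] distrib_left)
    show "n < N" if "real n \<le> (1 + \<alpha>) * real r" for n
      using that D(2) unfolding N_def by linarith
  qed (use nonneg k D assms in \<open>auto simp: N_def\<close>)
  obtain G where G: "(G, int k - 1, \<alpha>) \<in> instances \<alpha> r" "card (verts G) = card V + (N + r - 3)"
    "int (k * k) - 2 \<le> penalty A G (int k - 1)"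
    using expensive_instance .
  have "int k * (int N + 1) - (int k - 1) = int (k * N + 1)" by (simp add: algebra_simps)
  then have card_V: "card V = k * N + 1" unfolding V_def by (metis card_atLeastLessThan_int nat_int)
  let ?c = "real (card (verts G))" and ?d = "2 * real D + 3"
  have "card (verts G) = k * D + k + 1 + (D + r - 2)"
    by (simp add: G(2) card_V N_def algebra_simps)
  \<comment> \<open>Since \<open>r\<close> is at most \<open>D\<close>, the nodes added by the
    completion number less than \<open>2 * D\<close>, hence less than \<open>k * D\<close>.\<close>
  moreover have "2 * D \<le> k * D" using k by (intro mult_right_mono) auto
  moreover have "k * (2 * D + 3) = k * D + k * D + 3 * k" by (simp add: algebra_simps)
  ultimately have "card (verts G) \<le> k * (2 * D + 3)" "k \<le> card (verts G)"
    using D(1) k by linarith+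
  from this(1) have "?c \<le> real (k * (2 * D + 3))" by (simp only: of_nat_le_iff)
  then have "?c \<le> real k * ?d" by simp
  then have "?c / (16 * ?d) \<le> real k / 16" by (simp add: field_simps)
  then have "(?c / (16 * ?d))\<^sup>2 \<le> (real k / 16)\<^sup>2" by (intro power_mono) auto
  \<comment> \<open>The factor 16 is generous: \<open>k * k\<close> is at least 4, so subtracting 2
    still leaves at least half of it.\<close>
  also have "\<dots> \<le> real k * real k - 2"
  proof -
    have "2 * 2 \<le> real k * real k" using k by (intro mult_mono) auto
    then show ?thesis by (simp add: power2_eq_square)
  qed
  also have "\<dots> = real_of_int (int (k * k) - 2)" by simp
  also have "\<dots> \<le> real_of_int (penalty A G (int k - 1))" using G(3) by (simp only: of_int_le_iff)
  finally show "\<exists>G s. (G, s, \<alpha>) \<in> instances \<alpha> r \<and> card (verts G) \<ge> k \<and>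
       real_of_int (penalty A G s) \<ge>
         (real (card (verts G)) / (16 * (2 * real_of_int \<lfloor>(1 + \<alpha>) * real r\<rfloor> + 3)))\<^sup>2"
    using G(1) \<open>k \<le> card (verts G)\<close> D(2) by auto
qed

end
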